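(* Let $n\ge 2$ be an integer, let $f$ be a polyomino which is symmetric under rotation by $90$ degrees, and let $g$ be a polyomino. Let $\overline{|f|}$ denote the unique integer in $\{0,1,\dots,n-1\}$ congruent to $|f|$ modulo $n$. If $|f\star_n g|_1<\overline{|f|}\,|g|$, or if $|f\star_n g|_\infty<\mathrm{sgn}(\overline{|f|})\,|g|$, then copies of $g$ cannot tile the plane, translations and rotations being allowed.
   Context: A polyomino is a map $f:\mathbf{Z}\times\mathbf{Z}\to\mathbf{Z}$ taking only the values $0$ and $1$ and nonzero at only finitely many points; the value $1$ at $(n,m)$ is identified with the unit square $[n,n+1]\times[m,m+1]$, so a polyomino is a finite (not necessarily connected) set of unit grid squares. For a finitely supported map $h:\mathbf{Z}^2\to\mathbf{Z}$, $|h|_1=\sum_{n,m}|h(n,m)|$ and $|h|_\infty$ is the number of pairs $(n,m)$ with $h(n,m)\neq 0$; for a polyomino both equal the number of squares, written $|f|$. The convolution is $(f\star g)(n,m)=\sum_{k,l}f(k,l)g(n-k,m-l)$, and $f\star_n g$ is the map obtained by replacing each value $(f\star g)(p,q)$ by its residue in $\{0,1,\dots,n-1\}$ modulo $n$. "Symmetric under rotation by 90 degrees" means that the set of squares of $f$ is invariant under a rotation of the plane by $90$ degrees about some point. $\mathrm{sgn}(x)$ is $1$ if $x>0$ and $0$ if $x=0$. Copies of $g$ tile the plane if the plane is covered by images of $g$ under translations by integer vectors and rotations by multiples of $90$ degrees, with no two copies sharing a square. *)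

theory Defs
  imports Complex_Main "HOL-Library.Product_Plus"
begin

definition support :: "(int \<times> int \<Rightarrow> int) \<Rightarrow> (int \<times> int) set" where
  "support h = {p. h p \<noteq> 0}"

definition polyomino :: "(int \<times> int \<Rightarrow> int) \<Rightarrow> bool" where
  "polyomino f \<longleftrightarrow> range f \<subseteq> {0, 1} \<and> finite (support f)"

definition norm_1 :: "(int \<times> int \<Rightarrow> int) \<Rightarrow> int" where
  "norm_1 h = (\<Sum>p\<in>support h. \<bar>h p\<bar>)"

definition norm_inf :: "(int \<times> int \<Rightarrow> int) \<Rightarrow> nat" where
  "norm_inf h = card (support h)"

definition size_poly :: "(int \<times> int \<Rightarrow> int) \<Rightarrow> nat" where
  "size_poly f = card (support f)"

lemma norm_1_polyomino: "polyomino f \<Longrightarrow> norm_1 f = int (size_poly f)"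
proof -
  assume "polyomino f"
  then have "\<bar>f p\<bar> = 1" if "p \<in> support f" for p
    using that by (cases p) (fastforce simp: polyomino_def support_def)
  then show ?thesis
    by (simp add: norm_1_def size_poly_def)
qed

lemma norm_inf_polyomino: "norm_inf f = size_poly f"
  by (simp add: norm_inf_def size_poly_def)

(* The terms with (k, l) outside the support of f vanish, so for finitely supported f
   this is the sum over all of Z^2. *)
definition conv :: "(int \<times> int \<Rightarrow> int) \<Rightarrow> (int \<times> int \<Rightarrow> int) \<Rightarrow> int \<times> int \<Rightarrow> int" where
  "conv f g = (\<lambda>(n, m). \<Sum>(k, l)\<in>support f. f (k, l) * g (n - k, m - l))"

definition conv_mod ::
  "int \<Rightarrow> (int \<times> int \<Rightarrow> int) \<Rightarrow> (int \<times> int \<Rightarrow> int) \<Rightarrow> int \<times> int \<Rightarrow> int" where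
  "conv_mod n f g = (\<lambda>p. conv f g p mod n)"

definition unit_square :: "int \<times> int \<Rightarrow> (real \<times> real) set" where
  "unit_square = (\<lambda>(n, m). {of_int n..of_int n + 1} \<times> {of_int m..of_int m + 1})"

definition squares :: "(int \<times> int \<Rightarrow> int) \<Rightarrow> (real \<times> real) set set" where
  "squares f = unit_square ` support f"

definition rot90 :: "real \<times> real \<Rightarrow> real \<times> real" where
  "rot90 = (\<lambda>(x, y). (- y, x))"

definition rot90_about :: "real \<times> real \<Rightarrow> real \<times> real \<Rightarrow> real \<times> real" where
  "rot90_about c p = c + rot90 (p - c)"

(* The centre c is an arbitrary point of the plane, so rotations about lattice points
   and about centres of squares are both allowed. *)
definition rot90_symmetric :: "(int \<times> int \<Rightarrow> int) \<Rightarrow> bool" where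
  "rot90_symmetric f \<longleftrightarrow> (\<exists>c. (\<lambda>S. rot90_about c ` S) ` squares f = squares f)"

definition placement :: "nat \<Rightarrow> int \<times> int \<Rightarrow> real \<times> real \<Rightarrow> real \<times> real" where
  "placement k v p = (of_int (fst v), of_int (snd v)) + (rot90 ^^ k) p"

(* Rotations about other lattice points or about centres of squares differ from
   rotations about the origin by an integer translation. *)
definition copies :: "(int \<times> int \<Rightarrow> int) \<Rightarrow> (real \<times> real) set set set" where
  "copies g = {(\<lambda>S. placement k v ` S) ` squares g | k v. True}"

(* Every placement sends unit grid squares to unit grid squares, so disjointness of two
   copies as sets of squares says that they share no square; common edges are allowed. *)
definition tiles_plane :: "(int \<times> int \<Rightarrow> int) \<Rightarrow> bool" where
  "tiles_plane g \<longleftrightarrow> (\<exists>T \<subseteq> copies g. pairwise disjnt T \<and> \<Union> (\<Union> T) = UNIV)"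

end

theory Submission imports Defs begin

text \<open>
  Let \<open>\<phi>\<close> be a nonnegative subadditive function on the integers with \<open>\<phi> 0 = 0\<close>, and let the
  weight of \<open>g\<close> be the sum of \<open>\<phi> ((f \<star> g) p)\<close> over all cells \<open>p\<close>. Because \<open>f\<close> is symmetric
  under rotation, all copies of \<open>g\<close> have the same weight. Given a tiling, let \<open>U\<close> be the union of
  all the copies that meet a large box. Then \<open>f \<star> U\<close> is constantly \<open>|f|\<close> on a slightly smaller box,
  so \<open>U\<close> has weight at least \<open>\<phi> |f|\<close> times the area of the box, up to a boundary term. By
  subadditivity its weight is at most the number of copies times the weight of \<open>g\<close>, and the number
  of copies is the area of the box divided by \<open>|g|\<close>, again up to a boundary term. Hence \<open>g\<close> has
  weight at least \<open>\<phi> |f| \<cdot> |g|\<close>. The two norms are the cases \<open>\<phi> x = x mod n\<close> and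
  \<open>\<phi> x = sgn (x mod n)\<close>.
\<close>

section \<open>Weights of sets of cells\<close>

text \<open>This is the convolution of the indicator functions of \<open>A\<close> and
  \<open>B\<close>. With sets, moving a copy is taking an image and a tiling is a disjoint
  family.\<close>

definition conv_count :: "(int \<times> int) set \<Rightarrow> (int \<times> int) set \<Rightarrow> int \<times> int \<Rightarrow> int" where
  "conv_count A B p = int (card {a \<in> A. p - a \<in> B})"

text \<open>Leaving out cells with count 0 keeps the index set finite for finite \<open>A\<close>
  and \<open>B\<close>; nothing is lost when \<open>\<phi> 0 = 0\<close>.\<close>

definition weight :: "(int \<Rightarrow> int) \<Rightarrow> (int \<times> int) set \<Rightarrow> (int \<times> int) set \<Rightarrow> int" where
  "weight \<phi> A B = (\<Sum>p | conv_count A B p \<noteq> 0. \<phi> (conv_count A B p))"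

lemma finite_conv_count_support:
  assumes "finite A" "finite B"
  shows "finite {p. conv_count A B p \<noteq> 0}"
proof (rule finite_subset)
  show "{p. conv_count A B p \<noteq> 0} \<subseteq> (\<lambda>(a, b). a + b) ` (A \<times> B)"
  proof
    fix p assume "p \<in> {p. conv_count A B p \<noteq> 0}"
    then have "{a \<in> A. p - a \<in> B} \<noteq> {}"
      unfolding conv_count_def by (metis (mono_tags, lifting) card.empty mem_Collect_eq of_nat_0)
    then obtain a where "a \<in> A" "p - a \<in> B" by blast
    then show "p \<in> (\<lambda>(a, b). a + b) ` (A \<times> B)"
      by (intro image_eqI[of _ _ "(a, p - a)"]) auto
  qed
qed (use assms in auto)

lemma conv_count_Union:
  assumes "finite A" "finite \<T>" "pairwise disjnt \<T>"
  shows "conv_count A (\<Union>\<T>) p = (\<Sum>t\<in>\<T>. conv_count A t p)"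
proof -
  have "{a \<in> A. p - a \<in> \<Union>\<T>} = (\<Union>t\<in>\<T>. {a \<in> A. p - a \<in> t})" by auto
  moreover have "card (\<Union>t\<in>\<T>. {a \<in> A. p - a \<in> t}) = (\<Sum>t\<in>\<T>. card {a \<in> A. p - a \<in> t})"
    using assms by (intro card_UN_disjoint) (auto simp: pairwise_def disjnt_def)
  ultimately show ?thesis by (simp add: conv_count_def)
qed

lemma sum_le_weight:
  assumes "\<phi> 0 = 0" "\<And>x. \<phi> x \<ge> 0" "finite A" "finite B" "finite S"
  shows "(\<Sum>p\<in>S. \<phi> (conv_count A B p)) \<le> weight \<phi> A B"
proof -
  have "(\<Sum>p\<in>S. \<phi> (conv_count A B p)) = (\<Sum>p\<in>S \<inter> {p. conv_count A B p \<noteq> 0}. \<phi> (conv_count A B p))"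
    using assms by (intro sum.mono_neutral_right) auto
  also have "\<dots> \<le> weight \<phi> A B"
    unfolding weight_def using assms finite_conv_count_support[of A B]
    by (intro sum_mono2) auto
  finally show ?thesis .
qed

text \<open>Reduces the invariance of weights under a motion of \<open>B\<close> to finding a
  bijection of the cells that matches the counts.\<close>

lemma weight_bij:
  assumes "bij \<tau>" "\<And>q. conv_count A B' (\<tau> q) = conv_count A B q"
  shows "weight \<phi> A B' = weight \<phi> A B"
proof -
  have "bij_betw \<tau> {q. conv_count A B q \<noteq> 0} {p. conv_count A B' p \<noteq> 0}"
    using assms by (auto simp: bij_betw_def inj_on_def image_iff bij_def surj_def) metis
  then show ?thesis
    unfolding weight_def by (subst sum.reindex_bij_betw[symmetric]) (auto simp: assms(2))
qed

lemma bij_plus: "bij ((+) (v :: int \<times> int))"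
  by (rule bij_betw_byWitness[where f' = "\<lambda>p. p - v"]) auto

lemma weight_translate: "weight \<phi> A ((+) v ` B) = weight \<phi> A B"
proof (rule weight_bij[OF bij_plus[of v]])
  fix q
  have "{a \<in> A. v + q - a \<in> (+) v ` B} = {a \<in> A. q - a \<in> B}"
    by (simp add: add_diff_eq[symmetric] inj_image_mem_iff)
  then show "conv_count A ((+) v ` B) (v + q) = conv_count A B q"
    by (simp add: conv_count_def)
qed

definition rot_vec :: "int \<times> int \<Rightarrow> int \<times> int" where
  "rot_vec p = (- snd p, fst p)"

lemma rot_vec_diff: "rot_vec (p - q) = rot_vec p - rot_vec q"
  by (simp add: rot_vec_def)

lemma bij_rot_vec: "bij rot_vec"
  by (rule bij_betw_byWitness[where f' = "\<lambda>p. (snd p, - fst p)"]) (auto simp: rot_vec_def)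

text \<open>The only place where the symmetry of \<open>A\<close> acts: since
  \<open>c + rot_vec q - (rot_vec a + c) = rot_vec (q - a)\<close>, rotating \<open>B\<close> merely
  moves the whole convolution by \<open>q \<mapsto> c + rot_vec q\<close>.\<close>

lemma weight_rot_vec:
  assumes A: "(\<lambda>a. rot_vec a + c) ` A = A"
  shows "weight \<phi> A (rot_vec ` B) = weight \<phi> A B"
proof (rule weight_bij)
  show "bij (\<lambda>q. c + rot_vec q)"
    using bij_comp[OF bij_rot_vec bij_plus[of c]] by (simp add: o_def)
  fix q
  have inj: "inj rot_vec" using bij_rot_vec by (rule bij_is_inj)
  have "{a \<in> A. c + rot_vec q - a \<in> rot_vec ` B}
      = (\<lambda>a. rot_vec a + c) ` {a \<in> A. q - a \<in> B}" (is "?L = ?h ` ?R")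
  proof -
    have "?L = {a \<in> ?h ` A. c + rot_vec q - a \<in> rot_vec ` B}" using A by simp
    also have "\<dots> = ?h ` {a \<in> A. c + rot_vec q - ?h a \<in> rot_vec ` B}" by auto
    also have "\<dots> = ?h ` {a \<in> A. rot_vec (q - a) \<in> rot_vec ` B}" by (simp add: rot_vec_diff)
    finally show ?thesis by (simp add: inj_image_mem_iff[OF inj])
  qed
  moreover have "inj_on ?h ?R"
    using inj by (auto simp: inj_on_def)
  ultimately show "conv_count A (rot_vec ` B) (c + rot_vec q) = conv_count A B q"
    by (simp add: conv_count_def card_image)
qed

section \<open>Tilings by cells\<close>

text \<open>The rotation about the origin sends the cell with lower left corner \<open>(n, m)\<close> to the one with
  lower left corner \<open>(- m - 1, n)\<close>.\<close>

definition rot_cell :: "int \<times> int \<Rightarrow> int \<times> int" where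
  "rot_cell p = (-1, 0) + rot_vec p"

definition cell_copies :: "(int \<times> int) set \<Rightarrow> (int \<times> int) set set" where
  "cell_copies B = {(\<lambda>p. v + (rot_cell ^^ k) p) ` B | k v. True}"

lemma rot_cell_image: "rot_cell ` B = (+) (-1, 0) ` rot_vec ` B"
  by (simp add: image_image rot_cell_def)

lemma inj_rot_cell: "inj rot_cell"
  using bij_is_inj[OF bij_rot_vec] by (auto simp: inj_def rot_cell_def)

lemma weight_cell_copies:
  assumes "(\<lambda>a. rot_vec a + c) ` A = A" "t \<in> cell_copies B"
  shows "weight \<phi> A t = weight \<phi> A B"
proof -
  have rot: "weight \<phi> A ((rot_cell ^^ k) ` B) = weight \<phi> A B" for k
  proof (induction k)
    case (Suc k)
    have "(rot_cell ^^ Suc k) ` B = rot_cell ` (rot_cell ^^ k) ` B" by (simp add: image_comp)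
    then show ?case
      using Suc by (simp only: rot_cell_image weight_translate weight_rot_vec[OF assms(1)])
  qed simp
  obtain k v where "t = (+) v ` (rot_cell ^^ k) ` B"
    using assms(2) by (auto simp: cell_copies_def image_image)
  then show ?thesis by (simp only: weight_translate rot)
qed

lemma card_cell_copies:
  assumes "t \<in> cell_copies B"
  shows "card t = card B"
proof -
  obtain k v where t: "t = (\<lambda>p. v + (rot_cell ^^ k) p) ` B"
    using assms by (auto simp: cell_copies_def)
  have "inj (rot_cell ^^ k)"
    using inj_rot_cell by (rule inj_fn)
  then show ?thesis
    unfolding t by (intro card_image) (auto simp: inj_on_def)
qed

section \<open>Boxes, and the comparison of weight with area\<close>

definition box :: "int \<Rightarrow> (int \<times> int) set" where
  "box N = {-N..N} \<times> {-N..N}"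

lemma finite_box [simp]: "finite (box N)"
  by (simp add: box_def)

lemma card_box: "N \<ge> 0 \<Longrightarrow> int (card (box N)) = (2 * N + 1)\<^sup>2"
  by (simp add: box_def card_cartesian_product power2_eq_square)

lemma box_add: "p \<in> box M \<Longrightarrow> q \<in> box N \<Longrightarrow> p + q \<in> box (M + N)"
  by (cases p; cases q) (auto simp: box_def)

lemma box_diff: "p \<in> box M \<Longrightarrow> q \<in> box N \<Longrightarrow> p - q \<in> box (M + N)"
  by (cases p; cases q) (auto simp: box_def)

lemma finite_subset_box:
  assumes "finite B"
  obtains N where "N \<ge> 0" "B \<subseteq> box N"
proof -
  \<comment> \<open>The sum dominates every coordinate and, unlike a maximum, needs no special case
    for empty \<open>B\<close>.\<close>
  define N where "N = (\<Sum>p\<in>B. \<bar>fst p\<bar> + \<bar>snd p\<bar>)"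
  have "\<bar>fst p\<bar> + \<bar>snd p\<bar> \<le> N" if "p \<in> B" for p
    unfolding N_def using assms that by (intro member_le_sum) auto
  then have "B \<subseteq> box N" by (fastforce simp: box_def)
  moreover have "N \<ge> 0" unfolding N_def by (intro sum_nonneg) auto
  ultimately show thesis using that by blast
qed

text \<open>In a difference of two cells the translation and the shift \<open>(-1, 0)\<close> of
  \<open>rot_cell\<close> cancel; what remains is the linear rotation, which preserves
  boxes.\<close>

lemma cell_copies_diameter:
  assumes "B \<subseteq> box m" "t \<in> cell_copies B" "x \<in> t" "y \<in> t"
  shows "y - x \<in> box (2 * m)"
proof -
  obtain k v p q where "p \<in> B" "q \<in> B"
    and xy: "x = v + (rot_cell ^^ k) p" "y = v + (rot_cell ^^ k) q"
    using assms by (auto simp: cell_copies_def)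
  then have "q - p \<in> box (2 * m)" using box_diff[of q m p m] assms(1) by auto
  then have "(rot_cell ^^ k) q - (rot_cell ^^ k) p \<in> box (2 * m)"
  proof (induction k)
    case (Suc k)
    let ?d = "(rot_cell ^^ k) q - (rot_cell ^^ k) p"
    have "(rot_cell ^^ Suc k) q - (rot_cell ^^ Suc k) p = rot_vec ?d"
      by (simp add: rot_cell_def rot_vec_diff)
    moreover have "rot_vec ?d \<in> box (2 * m)"
      using Suc by (cases ?d) (auto simp: box_def rot_vec_def)
    ultimately show ?case by simp
  qed simp
  then show ?thesis by (simp add: xy)
qed

lemma weight_box_bound:
  assumes \<phi>: "\<phi> 0 = 0" "\<And>x. \<phi> x \<ge> 0" "\<And>x y. \<phi> (x + y) \<le> \<phi> x + \<phi> y"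
    and fin: "finite A" "finite B" and A: "(\<lambda>a. rot_vec a + c) ` A = A"
    and T: "T \<subseteq> cell_copies B" "pairwise disjnt T" "\<Union>T = UNIV"
    and boxes: "A \<subseteq> box e" "B \<subseteq> box m" and nonneg: "e \<ge> 0" "m \<ge> 0" "M \<ge> 0"
  shows "\<phi> (int (card A)) * int (card B) * (2 * M + 1)\<^sup>2
       \<le> weight \<phi> A B * (2 * (M + e + 2 * m) + 1)\<^sup>2"
proof -
  \<comment> \<open>The margin \<open>e\<close> ensures that, for \<open>p\<close> in
    \<open>box M\<close>, every cell \<open>p - a\<close> with \<open>a \<in> A\<close> is covered
    by \<open>\<T>\<close>. The further margin \<open>2 * m\<close> below is how far a copy meeting
    this box can stick out.\<close>
  define \<T> where "\<T> = {t \<in> T. t \<inter> box (M + e) \<noteq> {}}"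
  have sub: "t \<subseteq> box (M + e + 2 * m)" if "t \<in> \<T>" for t
  proof
    fix y assume "y \<in> t"
    obtain x where "x \<in> t" "x \<in> box (M + e)" using \<open>t \<in> \<T>\<close> by (auto simp: \<T>_def)
    then show "y \<in> box (M + e + 2 * m)"
      using box_add[of x "M + e" "y - x" "2 * m"] cell_copies_diameter[OF boxes(2), of t x y] T(1)
        \<open>t \<in> \<T>\<close> \<open>y \<in> t\<close> by (auto simp: \<T>_def)
  qed
  have fin_t: "finite t" if "t \<in> \<T>" for t using sub[OF that] finite_box by (rule finite_subset)
  have "\<T> \<subseteq> Pow (box (M + e + 2 * m))" using sub by blast
  then have fin_T: "finite \<T>" by (rule finite_subset) simp
  have disj: "pairwise disjnt \<T>" using T(2) by (rule pairwise_subset) (auto simp: \<T>_def)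
  have copy: "t \<in> cell_copies B" if "t \<in> \<T>" for t using that T(1) by (auto simp: \<T>_def)
  have "int (card \<T>) * int (card B) = int (\<Sum>t\<in>\<T>. card t)"
    using card_cell_copies[OF copy] by simp
  also have "(\<Sum>t\<in>\<T>. card t) = card (\<Union>\<T>)"
    using disj fin_t by (intro card_Union_disjoint[symmetric]) auto
  also have "int \<dots> \<le> int (card (box (M + e + 2 * m)))"
    using sub by (intro of_nat_mono card_mono) auto
  also have "\<dots> = (2 * (M + e + 2 * m) + 1)\<^sup>2" using nonneg by (intro card_box) auto
  finally have number: "int (card \<T>) * int (card B) \<le> (2 * (M + e + 2 * m) + 1)\<^sup>2" .
  have const: "conv_count A (\<Union>\<T>) p = int (card A)" if "p \<in> box M" for p
  proof -
    have "p - a \<in> \<Union>\<T>" if "a \<in> A" for a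
    proof -
      have "p - a \<in> box (M + e)" using \<open>p \<in> box M\<close> \<open>a \<in> A\<close> boxes(1) by (blast intro: box_diff)
      moreover obtain t where "t \<in> T" "p - a \<in> t" using T(3) by blast
      ultimately show ?thesis by (auto simp: \<T>_def)
    qed
    then have "{a \<in> A. p - a \<in> \<Union>\<T>} = A" by blast
    then show ?thesis by (simp add: conv_count_def)
  qed
  have subadd: "\<phi> (\<Sum>i\<in>I. h i) \<le> (\<Sum>i\<in>I. \<phi> (h i))" if "finite I"
    for I :: "(int \<times> int) set set" and h :: "(int \<times> int) set \<Rightarrow> int"
    using that
  proof (induction I)
    case (insert i I)
    then show ?case using \<phi>(3)[of "h i" "sum h I"] by simp
  qed (simp add: \<phi>)
  have "\<phi> (int (card A)) * (2 * M + 1)\<^sup>2 = (\<Sum>p\<in>box M. \<phi> (conv_count A (\<Union>\<T>) p))"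
    using const nonneg by (simp add: card_box)
  also have "\<dots> = (\<Sum>p\<in>box M. \<phi> (\<Sum>t\<in>\<T>. conv_count A t p))"
    by (simp add: conv_count_Union[OF fin(1) fin_T disj])
  also have "\<dots> \<le> (\<Sum>p\<in>box M. \<Sum>t\<in>\<T>. \<phi> (conv_count A t p))"
    by (intro sum_mono subadd fin_T)
  also have "\<dots> = (\<Sum>t\<in>\<T>. \<Sum>p\<in>box M. \<phi> (conv_count A t p))" by (rule sum.swap)
  also have "\<dots> \<le> (\<Sum>t\<in>\<T>. weight \<phi> A t)"
    using \<phi> fin fin_t by (intro sum_mono sum_le_weight) auto
  also have "\<dots> = int (card \<T>) * weight \<phi> A B"
    using weight_cell_copies[OF A copy] by simp
  \<comment> \<open>Multiplying by \<open>card B\<close> instead of dividing by it lets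
    \<open>number\<close> be applied even if \<open>B\<close> is empty.\<close>
  finally have "\<phi> (int (card A)) * (2 * M + 1)\<^sup>2 * int (card B)
      \<le> int (card \<T>) * weight \<phi> A B * int (card B)"
    by (rule mult_right_mono) simp
  also have "\<dots> = weight \<phi> A B * (int (card \<T>) * int (card B))" by simp
  also have "\<dots> \<le> weight \<phi> A B * (2 * (M + e + 2 * m) + 1)\<^sup>2"
    using number \<phi>(2) by (intro mult_left_mono) (auto simp: weight_def intro: sum_nonneg)
  finally show ?thesis by (simp add: mult_ac)
qed

text \<open>An integer substitute for letting \<open>M\<close> tend to infinity and comparing
  leading coefficients: if \<open>x \<ge> y + 1\<close>, one explicit \<open>M\<close> gives a
  contradiction.\<close>

lemma le_of_quadratic_bounds:
  fixes x y k :: int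
  assumes "k \<ge> 0" "y \<ge> 0"
    and bound: "\<And>M. M \<ge> 0 \<Longrightarrow> x * (2 * M + 1)\<^sup>2 \<le> y * (2 * (M + k) + 1)\<^sup>2"
  shows "x \<le> y"
proof (rule ccontr)
  assume "\<not> x \<le> y"
  \<comment> \<open>With \<open>a = 2 * M + 1 \<ge> 1\<close>, the excess of
    \<open>y * (a + 2 * k)\<^sup>2\<close> over \<open>y * a\<^sup>2\<close> is at most
    \<open>y * (4 * k + 4 * k\<^sup>2) * a = M * a\<close>, which is less than
    \<open>a\<^sup>2\<close>.\<close>
  define M where "M = y * (4 * k + 4 * k\<^sup>2)"
  have "M \<ge> 0" using assms by (simp add: M_def)
  let ?a = "2 * M + 1"
  have "(y + 1) * ?a\<^sup>2 \<le> x * ?a\<^sup>2" using \<open>\<not> x \<le> y\<close> by (intro mult_right_mono) auto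
  also have "\<dots> \<le> y * (?a + 2 * k)\<^sup>2"
    using bound[OF \<open>M \<ge> 0\<close>] by (simp add: algebra_simps)
  also have "\<dots> = y * ?a\<^sup>2 + y * (4 * k * ?a + 4 * k\<^sup>2)" by (simp add: power2_eq_square algebra_simps)
  also have "y * (4 * k * ?a + 4 * k\<^sup>2) \<le> y * (4 * k * ?a + 4 * k\<^sup>2 * ?a)"
    using assms \<open>M \<ge> 0\<close> by (intro mult_left_mono add_left_mono) (auto simp: algebra_simps)
  also have "\<dots> = M * ?a" by (simp add: M_def algebra_simps)
  finally have "?a * ?a \<le> M * ?a" by (simp add: power2_eq_square algebra_simps)
  then have "?a \<le> M" using \<open>M \<ge> 0\<close> by (simp add: mult_le_cancel_right)
  then show False using \<open>M \<ge> 0\<close> by simp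
qed

lemma weight_lower_bound:
  assumes "\<phi> 0 = 0" "\<And>x. \<phi> x \<ge> 0" "\<And>x y. \<phi> (x + y) \<le> \<phi> x + \<phi> y"
    and "finite A" "finite B" "(\<lambda>a. rot_vec a + c) ` A = A"
    and "T \<subseteq> cell_copies B" "pairwise disjnt T" "\<Union>T = UNIV"
  shows "\<phi> (int (card A)) * int (card B) \<le> weight \<phi> A B"
proof -
  obtain e m where em: "e \<ge> 0" "A \<subseteq> box e" "m \<ge> 0" "B \<subseteq> box m"
    using assms(4,5) finite_subset_box by metis
  show ?thesis
  proof (rule le_of_quadratic_bounds)
    show "e + 2 * m \<ge> 0" using em by simp
    show "weight \<phi> A B \<ge> 0" unfolding weight_def using assms(2) by (intro sum_nonneg) auto
    fix M :: int assume "M \<ge> 0"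
    then show "\<phi> (int (card A)) * int (card B) * (2 * M + 1)\<^sup>2
        \<le> weight \<phi> A B * (2 * (M + (e + 2 * m)) + 1)\<^sup>2"
      using weight_box_bound[of \<phi> A B c T e m M] assms em by (simp add: add.assoc)
  qed
qed

section \<open>From unit squares to cells\<close>

text \<open>Closed squares share edges and corners, so a cell is recognised by its centre, which
  lies in no other grid square.\<close>

lemma unit_square_midpoint_iff:
  "(of_int i + 1/2, of_int j + 1/2) \<in> unit_square p \<longleftrightarrow> p = (i, j)"
proof -
  have mid: "real_of_int i + 1/2 \<in> {of_int a..of_int a + 1} \<longleftrightarrow> a = i" for a i :: int
  proof
    assume "real_of_int i + 1/2 \<in> {of_int a..of_int a + 1}"
    then have "real_of_int a < of_int (i + 1)" "real_of_int i < of_int (a + 1)" by auto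
    then show "a = i" unfolding of_int_less_iff by linarith
  qed simp
  show ?thesis
    by (cases p) (simp only: unit_square_def prod.case mem_Times_iff fst_conv snd_conv mid prod.inject)
qed

lemma inj_unit_square: "inj unit_square"
proof (rule injI)
  fix p q assume eq: "unit_square p = unit_square q"
  have "(of_int (fst p) + 1/2, of_int (snd p) + 1/2) \<in> unit_square p"
    by (simp only: unit_square_midpoint_iff prod.collapse)
  then show "p = q"
    unfolding eq unit_square_midpoint_iff prod.collapse by (rule sym)
qed

text \<open>Here \<open>u\<close> is an arbitrary real vector, because the translation part of the
  symmetry of \<open>f\<close> is not known to be integral at first.\<close>

lemma rot90_unit_square:
  "(\<lambda>x. u + rot90 x) ` unit_square p
     = {fst u - snd p - 1..fst u - snd p} \<times> {snd u + fst p..snd u + fst p + 1}" (is "?L = ?R")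
proof
  show "?L \<subseteq> ?R" by (cases p; cases u) (auto simp: unit_square_def rot90_def)
  show "?R \<subseteq> ?L"
  proof
    fix z assume "z \<in> ?R"
    \<comment> \<open>The witness is \<open>z - u\<close> rotated back by 90 degrees.\<close>
    then show "z \<in> ?L"
      by (intro image_eqI[of _ _ "(snd z - snd u, fst u - fst z)"];
          cases p; cases u; cases z) (auto simp: unit_square_def rot90_def)
  qed
qed

lemma rot90_image_unit_square: "rot90 ` unit_square p = unit_square (rot_cell p)"
proof -
  have "rot90 ` unit_square p = (\<lambda>x. 0 + rot90 x) ` unit_square p" by simp
  also have "\<dots> = unit_square (rot_cell p)"
    unfolding rot90_unit_square
    by (cases p) (simp add: unit_square_def rot_cell_def rot_vec_def algebra_simps)
  finally show ?thesis .
qed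

lemma plus_image_unit_square:
  "(+) (of_int (fst v), of_int (snd v)) ` unit_square p = unit_square (v + p)" (is "?L = ?R")
proof
  show "?L \<subseteq> ?R" by (cases p; cases v) (auto simp: unit_square_def)
  show "?R \<subseteq> ?L"
  proof
    fix z assume "z \<in> ?R"
    then show "z \<in> ?L"
      by (intro image_eqI[of _ _ "z - (of_int (fst v), of_int (snd v))"];
          cases p; cases v; cases z) (auto simp: unit_square_def)
  qed
qed

lemma placement_unit_square: "placement k v ` unit_square p = unit_square (v + (rot_cell ^^ k) p)"
proof -
  have rot: "(rot90 ^^ k) ` unit_square p = unit_square ((rot_cell ^^ k) p)"
  proof (induction k)
    case (Suc k)
    have "(rot90 ^^ Suc k) ` unit_square p = rot90 ` (rot90 ^^ k) ` unit_square p"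
      by (simp add: image_comp)
    then show ?case by (simp add: Suc rot90_image_unit_square)
  qed simp
  have "placement k v ` unit_square p
      = (+) (of_int (fst v), of_int (snd v)) ` (rot90 ^^ k) ` unit_square p"
    by (simp add: image_image placement_def[abs_def])
  then show ?thesis by (simp only: rot plus_image_unit_square)
qed

lemma copies_eq: "copies g = (`) unit_square ` cell_copies (support g)"
proof -
  have "(\<lambda>S. placement k v ` S) ` squares g
      = unit_square ` (\<lambda>p. v + (rot_cell ^^ k) p) ` support g" for k v
    by (simp add: squares_def image_image placement_unit_square)
  then show ?thesis unfolding copies_def cell_copies_def by auto
qed

lemma tiles_plane_cells:
  assumes "tiles_plane g"
  obtains T where "T \<subseteq> cell_copies (support g)" "pairwise disjnt T" "\<Union>T = UNIV"
proof -
  obtain T' where T': "T' \<subseteq> copies g" "pairwise disjnt T'" "\<Union> (\<Union> T') = UNIV"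
    using assms by (auto simp: tiles_plane_def)
  define T where "T = {t \<in> cell_copies (support g). unit_square ` t \<in> T'}"
  have "pairwise disjnt T"
  proof (rule pairwiseI)
    fix s t assume st: "s \<in> T" "t \<in> T" "s \<noteq> t"
    then have "unit_square ` s \<noteq> unit_square ` t"
      by (simp add: inj_image_eq_iff[OF inj_unit_square])
    then have "disjnt (unit_square ` s) (unit_square ` t)"
      using st T'(2) by (auto simp: T_def pairwise_def)
    then show "disjnt s t" by (auto simp: disjnt_def)
  qed
  \<comment> \<open>The centre of the cell \<open>p\<close> is covered by some square of the tiling,
    and this can only be the square of \<open>p\<close> itself.\<close>
  moreover have "p \<in> \<Union>T" for p
  proof -
    obtain c S where "c \<in> T'" "S \<in> c" "(of_int (fst p) + 1/2, of_int (snd p) + 1/2) \<in> S"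
      using T'(3) by (metis UNIV_I UnionE)
    moreover obtain t where "t \<in> cell_copies (support g)" "c = unit_square ` t"
      using \<open>c \<in> T'\<close> T'(1) by (auto simp: copies_eq)
    ultimately show ?thesis by (auto simp: T_def unit_square_midpoint_iff)
  qed
  moreover have "T \<subseteq> cell_copies (support g)" by (auto simp: T_def)
  ultimately show thesis using that[of T] by blast
qed

text \<open>The centre of the rotation need not be integral, but the translation part of the rotation is,
  because some grid square is sent to a grid square.\<close>

lemma rot90_symmetric_cells:
  assumes "rot90_symmetric f"
  obtains c where "(\<lambda>a. rot_vec a + c) ` support f = support f"
proof (cases "support f = {}")
  case True
  then show thesis using that by simp
next
  case False
  obtain z where z: "(\<lambda>S. rot90_about z ` S) ` squares f = squares f"
    using assms by (auto simp: rot90_symmetric_def)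
  define u where "u = z - rot90 z"
  have "rot90_about z = (\<lambda>x. u + rot90 x)"
    by (auto simp: fun_eq_iff rot90_about_def u_def rot90_def split: prod.splits)
  with z have u: "(\<lambda>S. (\<lambda>x. u + rot90 x) ` S) ` squares f = squares f" by simp
  obtain p where "p \<in> support f" using False by blast
  then have "(\<lambda>x. u + rot90 x) ` unit_square p \<in> squares f"
    using u imageI[of "unit_square p" "squares f" "\<lambda>S. (\<lambda>x. u + rot90 x) ` S"]
    by (simp add: squares_def)
  then obtain q where "(\<lambda>x. u + rot90 x) ` unit_square p = unit_square q"
    unfolding squares_def by blast
  then have "{fst u - snd p - 1..fst u - snd p} \<times> {snd u + fst p..snd u + fst p + 1}
      = {real_of_int (fst q)..of_int (fst q) + 1} \<times> {real_of_int (snd q)..of_int (snd q) + 1}"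
    by (simp only: rot90_unit_square) (simp only: unit_square_def case_prod_beta)
  \<comment> \<open>The factors are nonempty intervals, so equal products have equal factors; their
    left endpoints make \<open>u\<close> integral.\<close>
  then have "fst u - snd p - 1 = of_int (fst q)" "snd u + fst p = of_int (snd q)"
    by (simp_all add: times_eq_iff Icc_eq_Icc)
  then have u_int: "u = (of_int (fst q + snd p + 1), of_int (snd q - fst p))"
    by (cases u) simp
  define v where "v = (fst q + snd p + 1, snd q - fst p)"
  \<comment> \<open>The shift \<open>(-1, 0)\<close> between \<open>rot_cell\<close> and
    \<open>rot_vec\<close> is absorbed into the translation.\<close>
  have "(\<lambda>x. u + rot90 x) ` unit_square a = unit_square (rot_vec a + (v + (-1, 0)))" for a
  proof -
    have "(\<lambda>x. u + rot90 x) ` unit_square a = placement 1 v ` unit_square a"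
      by (simp add: placement_def[abs_def] u_int v_def)
    then show ?thesis by (simp add: placement_unit_square rot_cell_def add_ac)
  qed
  then have "unit_square ` (\<lambda>a. rot_vec a + (v + (-1, 0))) ` support f = unit_square ` support f"
    using u by (simp add: squares_def image_image)
  then show thesis using that by (simp only: inj_image_eq_iff[OF inj_unit_square])
qed

section \<open>The two norms as weights\<close>

lemma polyomino_eq_indicator:
  assumes "polyomino f"
  shows "f p = of_bool (p \<in> support f)"
proof -
  have "f p \<in> {0, 1}" using assms by (auto simp: polyomino_def)
  then show ?thesis by (auto simp: support_def)
qed

lemma conv_eq_conv_count:
  assumes "polyomino f" "polyomino g"
  shows "conv f g p = conv_count (support f) (support g) p"
proof -
  have "conv f g p = (\<Sum>a\<in>support f. f a * g (p - a))"
    by (cases p) (auto simp: conv_def intro!: sum.cong)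
  also have "\<dots> = (\<Sum>a\<in>support f. of_bool (p - a \<in> support g))"
    using polyomino_eq_indicator[OF assms(1)] polyomino_eq_indicator[OF assms(2)]
    by (intro sum.cong) auto
  also have "\<dots> = conv_count (support f) (support g) p"
    using assms(1) by (simp add: conv_count_def polyomino_def sum.If_cases Int_def of_bool_def)
  finally show ?thesis .
qed

text \<open>Reduction modulo \<open>n\<close> can shrink the support, but a cell whose count is a
  multiple of \<open>n\<close> contributes 0 to either weight. Residues are nonnegative, so absolute
  values disappear and signs count the support.\<close>

lemma norms_eq_weight:
  assumes n: "n > 0" and fg: "polyomino f" "polyomino g"
  shows "norm_1 (conv_mod n f g) = weight (\<lambda>x. x mod n) (support f) (support g)"
    and "int (norm_inf (conv_mod n f g)) = weight (\<lambda>x. sgn (x mod n)) (support f) (support g)"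
proof -
  let ?C = "conv_count (support f) (support g)"
  have fin: "finite {p. ?C p \<noteq> 0}"
    using fg by (intro finite_conv_count_support) (auto simp: polyomino_def)
  have supp: "support (conv_mod n f g) = {p. ?C p mod n \<noteq> 0}"
    by (simp add: support_def conv_mod_def conv_eq_conv_count[OF fg])
  have sub: "{p. ?C p mod n \<noteq> 0} \<subseteq> {p. ?C p \<noteq> 0}" by auto
  show "norm_1 (conv_mod n f g) = weight (\<lambda>x. x mod n) (support f) (support g)"
    unfolding norm_1_def weight_def supp using n
    by (intro sum.mono_neutral_cong_left fin sub)
      (auto simp: conv_mod_def conv_eq_conv_count[OF fg])
  have "int (norm_inf (conv_mod n f g)) = (\<Sum>p | ?C p mod n \<noteq> 0. 1)"
    by (simp add: norm_inf_def supp)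
  also have "\<dots> = weight (\<lambda>x. sgn (x mod n)) (support f) (support g)"
    unfolding weight_def
  proof (intro sum.mono_neutral_cong_left fin sub)
    fix p assume "p \<in> {p. ?C p mod n \<noteq> 0}"
    then have "?C p mod n > 0" using n pos_mod_sign[of n "?C p"] by (auto simp: less_le)
    then show "1 = sgn (?C p mod n)" by simp
  qed auto
  finally show "int (norm_inf (conv_mod n f g))
    = weight (\<lambda>x. sgn (x mod n)) (support f) (support g)" .
qed

text \<open>Reducing the nonnegative sum of the two residues once more can only decrease it.\<close>

lemma mod_add_le:
  fixes n :: int
  assumes "n > 0"
  shows "(x + y) mod n \<le> x mod n + y mod n"
proof -
  have "(x + y) mod n = (x mod n + y mod n) mod n" by (simp add: mod_add_eq)
  also have "\<dots> \<le> x mod n + y mod n" using assms by (intro zmod_le_nonneg_dividend) simp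
  finally show ?thesis .
qed

text \<open>The signs are 0 or 1, and by \<open>mod_add_le\<close> the residue of the sum vanishes
  when both residues do.\<close>

lemma sgn_mod_add_le:
  fixes n :: int
  assumes "n > 0"
  shows "sgn ((x + y) mod n) \<le> sgn (x mod n) + sgn (y mod n)"
  using mod_add_le[OF assms, of x y] pos_mod_sign[OF assms, of x] pos_mod_sign[OF assms, of y]
  by (auto simp: sgn_if)

theorem theorem1:
  fixes n :: int and f g :: "int \<times> int \<Rightarrow> int"
  assumes "n \<ge> 2"
    and "polyomino f" and "rot90_symmetric f"
    and "polyomino g"
    and "norm_1 (conv_mod n f g) < (int (size_poly f) mod n) * int (size_poly g) \<or>
         int (norm_inf (conv_mod n f g)) < sgn (int (size_poly f) mod n) * int (size_poly g)"
  shows "\<not> tiles_plane g"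
proof
  assume "tiles_plane g"
  then obtain T where T: "T \<subseteq> cell_copies (support g)" "pairwise disjnt T" "\<Union>T = UNIV"
    by (rule tiles_plane_cells)
  obtain c where c: "(\<lambda>a. rot_vec a + c) ` support f = support f"
    using assms(3) by (rule rot90_symmetric_cells)
  have n: "n > 0" using assms(1) by simp
  have fin: "finite (support f)" "finite (support g)"
    using assms(2,4) by (auto simp: polyomino_def)
  have sgn_nonneg: "sgn (x mod n) \<ge> 0" for x :: int
    using pos_mod_sign[OF n, of x] by (simp add: sgn_if)
  have "int (size_poly f) mod n * int (size_poly g) \<le> norm_1 (conv_mod n f g)"
    unfolding norms_eq_weight(1)[OF n assms(2,4)] size_poly_def
    using n mod_add_le[OF n] by (intro weight_lower_bound[of "\<lambda>x. x mod n", OF _ _ _ fin c T]) auto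
  moreover have "sgn (int (size_poly f) mod n) * int (size_poly g) \<le> int (norm_inf (conv_mod n f g))"
    unfolding norms_eq_weight(2)[OF n assms(2,4)] size_poly_def
    using sgn_nonneg sgn_mod_add_le[OF n]
    by (intro weight_lower_bound[of "\<lambda>x. sgn (x mod n)", OF _ _ _ fin c T]) auto
  \<comment> \<open>Each of the two bounds refutes one alternative of the hypothesis.\<close>
  ultimately show False using assms(5) by linarith
qed

end
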